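(* Let $X$ be a Banach space and $C\subset X$ a non-empty, closed, convex and bounded set, let $\mathcal{M}$ be the space of nonexpansive mappings $F:C\to\mathcal{K}(C)$ with the metric $\rho$ of uniform convergence, let $x_0\in C$, and let $(\beta_n)_{n\in\mathbb{N}}$ be a decreasing sequence of positive real numbers with $\beta_n\to 0$. For $n\in\mathbb{N}$ let $\mathcal{A}_n(x_0)$ be the set of all $F\in\mathcal{M}$ for which there exists $R>0$ such that for all $v_0,\dots,v_n\in C$ with $\|v_0-x_0\|<R$ and $v_k\in P_{F(v_{k-1})}(v_{k-1})$ for $1\le k\le n$ one has $\mathrm{diam}\big(P_{F(v_k)}(v_k)\big)\le\beta_n$ for all $0\le k\le n$. Then for every $n\in\mathbb{N}$ the set $\mathcal{A}_n(x_0)$ contains an open and dense subset of $\mathcal{M}$. Moreover, the set $\mathcal{A}(x_0)=\bigcap_{n\in\mathbb{N}}\mathcal{A}_n(x_0)$ is residual in $\mathcal{M}$.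
   Context: $\mathcal{K}(C)$ is the set of non-empty compact subsets of $C$ with the Pompeiu-Hausdorff distance $H(A,B)=\max\{\sup_{a\in A}\inf_{b\in B}\|a-b\|,\ \sup_{b\in B}\inf_{a\in A}\|a-b\|\}$. A mapping $F:C\to\mathcal{K}(C)$ is nonexpansive if $H(F(x),F(y))\le\|x-y\|$ for all $x,y\in C$. $\mathcal{M}$ denotes the set of all such mappings, with the complete metric $\rho(F,G)=\sup_{x\in C}H(F(x),G(x))$. For $M\subset X$ and $x\in X$, $P_M(x)=\{y\in M:\|x-y\|=\inf_{w\in M}\|x-w\|\}$. $\mathrm{diam}(M)=\sup_{x,y\in M}\|x-y\|$. A set is meagre if it is a countable union of nowhere dense sets; a residual set is the complement of a meagre set. *)

theory Defs
  imports "HOL-Analysis.Analysis"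
begin

definition compacts :: "'a::metric_space set \<Rightarrow> 'a set set" where
  "compacts C = {K. K \<noteq> {} \<and> K \<subseteq> C \<and> compact K}"

definition hausdorff_distance :: "'a::metric_space set \<Rightarrow> 'a set \<Rightarrow> real" where
  "hausdorff_distance A B = max (SUP a\<in>A. infdist a B) (SUP b\<in>B. infdist b A)"

text \<open>Mappings with domain \<^term>\<open>C\<close> are represented by functions that are extensional
  outside \<^term>\<open>C\<close>, so that distinct elements of the following set are distinct mappings on
  \<^term>\<open>C\<close>.\<close>

definition nonexpansive_maps :: "'a::metric_space set \<Rightarrow> ('a \<Rightarrow> 'a set) set" where
  "nonexpansive_maps C =
    {F \<in> C \<rightarrow>\<^sub>E compacts C. \<forall>x\<in>C. \<forall>y\<in>C. hausdorff_distance (F x) (F y) \<le> dist x y}"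

text \<open>The value 0 off the carrier is only there because the locale \<^locale>\<open>Metric_space\<close> demands
  nonnegativity and symmetry on the whole type.\<close>

definition unif_dist :: "'a::metric_space set \<Rightarrow> ('a \<Rightarrow> 'a set) \<Rightarrow> ('a \<Rightarrow> 'a set) \<Rightarrow> real" where
  "unif_dist C F G =
    (if F \<in> nonexpansive_maps C \<and> G \<in> nonexpansive_maps C
     then SUP x\<in>C. hausdorff_distance (F x) (G x) else 0)"

definition nonexpansive_topology :: "'a::metric_space set \<Rightarrow> ('a \<Rightarrow> 'a set) topology" where
  "nonexpansive_topology C = Metric_space.mtopology (nonexpansive_maps C) (unif_dist C)"

definition proj_set :: "'a::metric_space set \<Rightarrow> 'a \<Rightarrow> 'a set" where
  "proj_set M x = {y \<in> M. dist x y = infdist x M}"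

text \<open>Only the values \<open>v 0, \<dots>, v n\<close> of the sequence \<open>v\<close> are constrained or used.\<close>

definition small_proj_maps ::
    "'a::real_normed_vector set \<Rightarrow> 'a \<Rightarrow> (nat \<Rightarrow> real) \<Rightarrow> nat \<Rightarrow> ('a \<Rightarrow> 'a set) set" where
  "small_proj_maps C x0 \<beta> n =
    {F \<in> nonexpansive_maps C. \<exists>R>0. \<forall>v :: nat \<Rightarrow> 'a.
       (\<forall>k\<le>n. v k \<in> C) \<and> norm (v 0 - x0) < R \<and>
       (\<forall>k\<in>{1..n}. v k \<in> proj_set (F (v (k - 1))) (v (k - 1)))
       \<longrightarrow> (\<forall>k\<le>n. diameter (proj_set (F (v k)) (v k)) \<le> \<beta> n)}"

definition nowhere_dense_in :: "'a topology \<Rightarrow> 'a set \<Rightarrow> bool" where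
  "nowhere_dense_in X S \<longleftrightarrow> S \<subseteq> topspace X \<and> X interior_of (X closure_of S) = {}"

definition meagre_in :: "'a topology \<Rightarrow> 'a set \<Rightarrow> bool" where
  "meagre_in X S \<longleftrightarrow> (\<exists>\<N>. countable \<N> \<and> (\<forall>N\<in>\<N>. nowhere_dense_in X N) \<and> S = \<Union>\<N>)"

definition residual_in :: "'a topology \<Rightarrow> 'a set \<Rightarrow> bool" where
  "residual_in X S \<longleftrightarrow> S \<subseteq> topspace X \<and> meagre_in X (topspace X - S)"

lemma hausdorff_distance_commute: "hausdorff_distance A B = hausdorff_distance B A"
  by (simp add: hausdorff_distance_def max.commute)

lemma bdd_above_infdist:
  assumes "bounded A" "B \<noteq> {}"
  shows "bdd_above ((\<lambda>a. infdist a B) ` A)"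
proof -
  obtain b where b: "b \<in> B" using assms by blast
  obtain e where "\<And>a. a \<in> A \<Longrightarrow> dist b a \<le> e"
    using assms(1) bounded_any_center[of A b] by blast
  then show ?thesis
    by (intro bdd_aboveI2[of _ _ e]) (metis b dist_commute infdist_le2)
qed

lemma infdist_le_hausdorff_distance:
  assumes "bounded A" "B \<noteq> {}" "a \<in> A"
  shows "infdist a B \<le> hausdorff_distance A B"
  using cSUP_upper[OF assms(3) bdd_above_infdist[OF assms(1,2)]]
  by (simp add: hausdorff_distance_def max.coboundedI1)

lemma hausdorff_distance_leI:
  assumes "A \<noteq> {}" "B \<noteq> {}"
    "\<And>a. a \<in> A \<Longrightarrow> infdist a B \<le> e" "\<And>b. b \<in> B \<Longrightarrow> infdist b A \<le> e"
  shows "hausdorff_distance A B \<le> e"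
  unfolding hausdorff_distance_def using assms by (auto intro!: cSUP_least)

lemma hausdorff_distance_nonneg:
  assumes "bounded A" "A \<noteq> {}" "B \<noteq> {}"
  shows "0 \<le> hausdorff_distance A B"
  by (metis assms ex_in_conv infdist_le_hausdorff_distance infdist_nonneg order_trans)

lemma infdist_attains_compact:
  assumes "compact B" "B \<noteq> {}"
  shows "\<exists>b\<in>B. infdist a B = dist a b"
proof -
  have "continuous_on B (dist a)" by (intro continuous_intros)
  then obtain b where b: "b \<in> B" "\<And>y. y \<in> B \<Longrightarrow> dist a b \<le> dist a y"
    using continuous_attains_inf[OF assms] by blast
  have "dist a b \<le> infdist a B"
    unfolding infdist_notempty[OF assms(2)] using assms(2) b by (intro cINF_greatest) auto
  then show ?thesis using b(1) infdist_le[of b B a] by (intro bexI[of _ b]) auto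
qed

lemma infdist_triangle_hausdorff_distance:
  assumes "compact A" "A \<noteq> {}" "compact B" "B \<noteq> {}" "C \<noteq> {}" "a \<in> A"
  shows "infdist a C \<le> hausdorff_distance A B + hausdorff_distance B C"
proof -
  obtain b where b: "b \<in> B" "infdist a B = dist a b"
    using infdist_attains_compact[OF assms(3,4), of a] by metis
  have "infdist a C \<le> infdist b C + dist a b" by (rule infdist_triangle)
  also have "infdist b C \<le> hausdorff_distance B C"
    using assms b by (simp add: infdist_le_hausdorff_distance compact_imp_bounded)
  also have "dist a b \<le> hausdorff_distance A B"
    using assms b by (metis infdist_le_hausdorff_distance compact_imp_bounded)
  finally show ?thesis by simp
qed

lemma hausdorff_distance_triangle:
  assumes "compact A" "A \<noteq> {}" "compact B" "B \<noteq> {}" "compact C" "C \<noteq> {}"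
  shows "hausdorff_distance A C \<le> hausdorff_distance A B + hausdorff_distance B C"
  using assms infdist_triangle_hausdorff_distance[of A B C]
    infdist_triangle_hausdorff_distance[of C B A]
  by (intro hausdorff_distance_leI) (auto simp: hausdorff_distance_commute add.commute)

lemma hausdorff_distance_eq_0_iff:
  assumes "compact A" "A \<noteq> {}" "compact B" "B \<noteq> {}"
  shows "hausdorff_distance A B = 0 \<longleftrightarrow> A = B"
proof
  have sub: "S \<subseteq> T" if "compact S" "compact T" "T \<noteq> {}" "hausdorff_distance S T = 0"
    for S T :: "'a set"
  proof
    fix s assume "s \<in> S"
    then have "infdist s T = 0"
      using infdist_le_hausdorff_distance[of S T s] that infdist_nonneg[of s T] compact_imp_bounded
      by fastforce
    then show "s \<in> T"
      using that in_closed_iff_infdist_zero compact_imp_closed by blast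
  qed
  assume "hausdorff_distance A B = 0"
  then show "A = B" using sub assms by (metis hausdorff_distance_commute subset_antisym)
next
  assume "A = B"
  then show "hausdorff_distance A B = 0" using assms by (simp add: hausdorff_distance_def)
qed

lemma bdd_above_hausdorff_distance:
  assumes "bounded C" "F \<in> C \<rightarrow>\<^sub>E compacts C" "G \<in> C \<rightarrow>\<^sub>E compacts C"
  shows "bdd_above ((\<lambda>x. hausdorff_distance (F x) (G x)) ` C)"
proof (rule bdd_aboveI2)
  fix x assume x: "x \<in> C"
  have *: "infdist a B \<le> diameter C" if a: "a \<in> C" and B: "B \<in> compacts C" for a B
  proof -
    obtain b where "b \<in> B" "b \<in> C" using B by (auto simp: compacts_def)
    then show ?thesis using a assms(1) infdist_le2 diameter_bounded_bound by blast
  qed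
  have "F x \<in> compacts C" "G x \<in> compacts C" using x assms by auto
  then show "hausdorff_distance (F x) (G x) \<le> diameter C"
    using * by (intro hausdorff_distance_leI) (auto simp: compacts_def)
qed

lemma Metric_space_nonexpansive_maps:
  assumes "bounded C" "C \<noteq> {}"
  shows "Metric_space (nonexpansive_maps C) (unif_dist C)"
proof -
  let ?M = "nonexpansive_maps C"
  have comp: "compact (F x)" "F x \<noteq> {}" if "F \<in> ?M" "x \<in> C" for F x
    using that by (auto simp: nonexpansive_maps_def compacts_def)
  have upper: "hausdorff_distance (F x) (G x) \<le> unif_dist C F G"
    if "F \<in> ?M" "G \<in> ?M" "x \<in> C" for F G x
    using that bdd_above_hausdorff_distance[OF assms(1), of F G]
    by (auto simp: unif_dist_def nonexpansive_maps_def intro!: cSUP_upper)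
  have least: "unif_dist C F G \<le> e"
    if "F \<in> ?M" "G \<in> ?M" "\<And>x. x \<in> C \<Longrightarrow> hausdorff_distance (F x) (G x) \<le> e" for F G e
    using that assms(2) by (auto simp: unif_dist_def intro!: cSUP_least)
  have H0: "0 \<le> hausdorff_distance (F x) (G x)" if "F \<in> ?M" "G \<in> ?M" "x \<in> C" for F G x
    using that comp by (simp add: hausdorff_distance_nonneg compact_imp_bounded)
  have nonneg: "0 \<le> unif_dist C F G" for F G
  proof (cases "F \<in> ?M \<and> G \<in> ?M")
    case True
    obtain x where "x \<in> C" using assms(2) by blast
    then show ?thesis using True H0 upper by (meson order_trans)
  qed (auto simp: unif_dist_def)
  show ?thesis
  proof
    show "0 \<le> unif_dist C F G" for F G by (rule nonneg)
    show "unif_dist C F G = unif_dist C G F" for F G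
      by (simp add: unif_dist_def hausdorff_distance_commute conj_commute)
    show "unif_dist C F G = 0 \<longleftrightarrow> F = G" if FG: "F \<in> ?M" "G \<in> ?M" for F G
    proof
      assume "unif_dist C F G = 0"
      then have "F x = G x" if "x \<in> C" for x
        using upper[OF FG that] H0[OF FG that] comp[OF FG(1) that] comp[OF FG(2) that]
          hausdorff_distance_eq_0_iff[of "F x" "G x"] by auto
      then show "F = G"
        using FG by (auto simp: nonexpansive_maps_def intro: PiE_ext)
    next
      assume "F = G"
      then have "unif_dist C F G \<le> 0"
        using FG comp by (intro least) (auto simp: hausdorff_distance_def)
      then show "unif_dist C F G = 0" using nonneg[of F G] by simp
    qed
    show "unif_dist C F K \<le> unif_dist C F G + unif_dist C G K"
      if "F \<in> ?M" "G \<in> ?M" "K \<in> ?M" for F G K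
    proof (rule least)
      fix x assume x: "x \<in> C"
      have "hausdorff_distance (F x) (K x)
          \<le> hausdorff_distance (F x) (G x) + hausdorff_distance (G x) (K x)"
        using that x comp by (intro hausdorff_distance_triangle) auto
      also have "\<dots> \<le> unif_dist C F G + unif_dist C G K"
        using that x upper by (intro add_mono) auto
      finally show "hausdorff_distance (F x) (K x) \<le> \<dots>" .
    qed (use that in auto)
  qed
qed

end

theory Submission
  imports Defs
begin

text \<open>If the values of \<open>F\<close> have unique nearest points along the orbit of \<open>x0\<close>, that is,
  \<open>P\<^bsub>F(p k)\<^esub>(p k) = {p (k + 1)}\<close> for \<open>k \<le> n\<close> and \<open>p 0 = x0\<close>, then by upper semicontinuity of
  the metric projection a whole ball around \<open>F\<close> lies in \<open>\<A>\<^sub>n(x0)\<close>. Such maps are dense: contracting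
  towards a point first makes \<open>F\<close> a strict contraction, which leaves room to replace \<open>F y\<close> by its
  image under \<open>w \<mapsto> w + \<phi>(y, w) (p n - w)\<close>, where \<open>\<phi>\<close> is a small bump function around
  \<open>(p n, q)\<close> and \<open>q\<close> is a nearest point to \<open>p n\<close> in \<open>F (p n)\<close>. This makes the image of \<open>q\<close> the only
  nearest point, and it keeps the earlier orbit points if \<open>p n\<close> differs from all of them; if it
  coincides with one of them, the orbit is periodic from then on and nothing needs to be changed.\<close>

section \<open>Set-valued Lipschitz maps and orbits with unique nearest points\<close>

definition lipschitz_maps :: "real \<Rightarrow> 'a::metric_space set \<Rightarrow> ('a \<Rightarrow> 'a set) set" where
  "lipschitz_maps L C =
    {F \<in> C \<rightarrow>\<^sub>E compacts C. \<forall>x\<in>C. \<forall>y\<in>C. hausdorff_distance (F x) (F y) \<le> L * dist x y}"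

text \<open>Once \<open>p 0\<close> is given, the recursion determines \<open>p 1\<close>, ...,
  \<open>p n\<close>; later values of \<open>p\<close> are free, and \<open>n = 0\<close> imposes
  nothing. An orbit can therefore be prolonged by updating the single entry
  \<open>Suc n\<close>.\<close>

definition unique_orbit :: "('a::metric_space \<Rightarrow> 'a set) \<Rightarrow> nat \<Rightarrow> (nat \<Rightarrow> 'a) \<Rightarrow> bool" where
  "unique_orbit F n p \<longleftrightarrow> (\<forall>k<n. proj_set (F (p k)) (p k) = {p (Suc k)})"

lemma nonexpansive_maps_eq: "nonexpansive_maps C = lipschitz_maps 1 C"
  by (simp add: nonexpansive_maps_def lipschitz_maps_def)

lemma lipschitz_maps_mono: "L \<le> L' \<Longrightarrow> lipschitz_maps L C \<subseteq> lipschitz_maps L' C"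
  unfolding lipschitz_maps_def using mult_right_mono[OF _ zero_le_dist] order_trans by blast

lemma lipschitz_mapsD:
  assumes "F \<in> lipschitz_maps L C" "x \<in> C"
  shows "F x \<noteq> {}" "F x \<subseteq> C" "compact (F x)"
  using assms by (auto simp: lipschitz_maps_def compacts_def)

lemma hausdorff_distance_le_unif_dist:
  assumes "bounded C" "F \<in> nonexpansive_maps C" "G \<in> nonexpansive_maps C" "x \<in> C"
  shows "hausdorff_distance (F x) (G x) \<le> unif_dist C F G"
  using assms bdd_above_hausdorff_distance[of C F G]
  by (auto simp: unif_dist_def nonexpansive_maps_def intro!: cSUP_upper)

lemma unif_dist_leI:
  assumes "C \<noteq> {}" "F \<in> nonexpansive_maps C" "G \<in> nonexpansive_maps C"
    "\<And>x. x \<in> C \<Longrightarrow> hausdorff_distance (F x) (G x) \<le> e"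
  shows "unif_dist C F G \<le> e"
  using assms by (auto simp: unif_dist_def intro!: cSUP_least)

section \<open>Metric projections onto compact sets\<close>

lemma hausdorff_distance_near_point:
  assumes "compact A" "compact B" "B \<noteq> {}" "a \<in> A"
  obtains b where "b \<in> B" "dist a b \<le> hausdorff_distance A B"
  using infdist_attains_compact[OF assms(2,3), of a]
    infdist_le_hausdorff_distance[OF compact_imp_bounded[OF assms(1)] assms(3,4)] by auto

lemma proj_set_nonempty:
  assumes "compact M" "M \<noteq> {}"
  obtains q where "q \<in> proj_set M x"
  using infdist_attains_compact[OF assms, of x] by (auto simp: proj_set_def)

lemma proj_set_le: "q \<in> proj_set M x \<Longrightarrow> w \<in> M \<Longrightarrow> dist x q \<le> dist x w"
  unfolding proj_set_def using infdist_le[of w M x] by auto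

lemma proj_set_eq_singletonI:
  assumes "q \<in> M" "\<And>w. w \<in> M \<Longrightarrow> w \<noteq> q \<Longrightarrow> dist x q < dist x w"
  shows "proj_set M x = {q}"
proof -
  have "infdist x M = dist x q"
  proof (rule antisym)
    show "dist x q \<le> infdist x M"
      using assms infdist_notempty[of M x] by (fastforce intro!: cINF_greatest)
  qed (simp add: assms(1) infdist_le)
  then show ?thesis
    using assms by (force simp: proj_set_def)
qed

text \<open>By compactness, the points of \<open>K\<close> away from \<open>q\<close> are farther
  from \<open>p\<close> than \<open>q\<close> is, by a fixed gap \<open>c\<close>. A nearest point
  \<open>u\<close> of \<open>L\<close> has a close neighbour \<open>w\<close> in \<open>K\<close>
  whose distance to \<open>p\<close> exceeds the minimum by less than this gap, so \<open>w\<close>,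
  and with it \<open>u\<close>, is near \<open>q\<close>.\<close>

lemma proj_set_upper_semicontinuous:
  fixes K :: "'a::metric_space set"
  assumes K: "compact K" "K \<noteq> {}" and q: "proj_set K p = {q}" and "e > 0"
  obtains d where "d > 0"
    "\<And>L v u. \<lbrakk>compact L; L \<noteq> {}; hausdorff_distance K L < d; dist v p < d; u \<in> proj_set L v\<rbrakk>
      \<Longrightarrow> dist u q < e"
proof -
  define K' where "K' = K - ball q (e/2)"
  have inf: "infdist p K = dist p q" using q by (auto simp: proj_set_def)
  obtain c where c: "c > 0" "\<And>w. w \<in> K' \<Longrightarrow> infdist p K + c \<le> dist p w"
  proof (cases "K' = {}")
    case True
    then show ?thesis using that[of 1] by simp
  next
    case False
    have "compact K'" unfolding K'_def using K by (simp add: compact_diff)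
    then obtain w0 where w0: "w0 \<in> K'" "infdist p K' = dist p w0"
      using infdist_attains_compact[OF _ False] by blast
    have "w0 \<in> K" "w0 \<noteq> q" using w0 \<open>e > 0\<close> by (auto simp: K'_def)
    then have "w0 \<notin> proj_set K p" using q by auto
    then have "infdist p K < dist p w0"
      using \<open>w0 \<in> K\<close> infdist_le[of w0 K p] by (auto simp: proj_set_def)
    then show ?thesis
      using that[of "dist p w0 - infdist p K"] w0 infdist_le[of _ K' p] by auto
  qed
  \<comment> \<open>Comparing \<open>dist p w\<close> with \<open>dist p q\<close> through
    \<open>v\<close>, \<open>u\<close> and \<open>l\<close> costs four errors of size
    \<open>d\<close>, which \<open>c/6\<close> keeps below the gap. The bound \<open>e/4\<close>
    together with the radius \<open>e/2\<close> stays below \<open>e\<close>.\<close>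
  define d where "d = min (c/6) (e/4)"
  show ?thesis
  proof (rule that[of d])
    show "d > 0" using c \<open>e > 0\<close> by (simp add: d_def)
    fix L v u
    assume L: "compact L" "L \<noteq> {}" and H: "hausdorff_distance K L < d"
      and v: "dist v p < d" and u: "u \<in> proj_set L v"
    obtain w where w: "w \<in> K" "dist u w \<le> hausdorff_distance L K"
      using hausdorff_distance_near_point[OF L(1) K, of u] u by (auto simp: proj_set_def)
    have "q \<in> K" using q by (auto simp: proj_set_def)
    then obtain l where l: "l \<in> L" "dist q l \<le> hausdorff_distance K L"
      using hausdorff_distance_near_point[OF K(1) L] by blast
    have uw: "dist u w < d" using w H by (simp add: hausdorff_distance_commute)
    have ql: "dist q l < d" using l H by simp
    have vu: "dist v u \<le> dist v l" using proj_set_le[OF u l(1)] .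
    have "dist p w < dist p q + c"
    proof -
      have "dist p w \<le> dist v p + dist v u + dist u w"
        using dist_triangle[of p w v] dist_triangle[of v w u] by (simp add: dist_commute)
      moreover have "dist v l \<le> dist v p + dist p q + dist q l"
        using dist_triangle[of v l p] dist_triangle[of p l q] by simp
      ultimately have "dist p w < dist p q + 4 * d" using uw ql v vu by linarith
      moreover have "6 * d \<le> c" by (simp add: d_def)
      ultimately show ?thesis using \<open>d > 0\<close> by linarith
    qed
    then have "w \<in> ball q (e/2)" using c(2)[of w] w inf by (auto simp: K'_def)
    moreover have "d \<le> e/4" by (simp add: d_def)
    ultimately show "dist u q < e"
      using uw dist_triangle[of u q w] \<open>e > 0\<close> by (simp add: dist_commute)
  qed
qed

section \<open>Stability of unique orbits under perturbation\<close>

lemma unique_orbit_in: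
  assumes "F \<in> lipschitz_maps L C" "unique_orbit F n p" "p 0 \<in> C" "k \<le> n"
  shows "p k \<in> C"
  using assms(4)
proof (induction k)
  case (Suc k)
  then have "proj_set (F (p k)) (p k) = {p (Suc k)}" "p k \<in> C"
    using assms(2) by (auto simp: unique_orbit_def)
  then have "p (Suc k) \<in> F (p k)" "p k \<in> C"
    by (auto simp: proj_set_def)
  then show ?case using lipschitz_mapsD(2)[OF assms(1)] by blast
qed (use assms in simp)

text \<open>Upper semicontinuity at \<open>p n\<close> controls the next orbit point. The induction
  keeps \<open>e\<close> arbitrary, because precision \<open>e\<close> at \<open>p (Suc n)\<close>
  may demand a finer precision at \<open>p n\<close>. One \<open>r\<close> serves all
  \<open>G\<close> and all choices of nearest points.\<close>

lemma unique_orbit_stable: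
  assumes C: "bounded C" and F: "F \<in> nonexpansive_maps C"
    and p: "unique_orbit F n p" "p 0 \<in> C" and "e > 0"
  shows "\<exists>r>0. \<forall>G\<in>nonexpansive_maps C. \<forall>v. unif_dist C F G < r \<longrightarrow> v 0 \<in> C \<longrightarrow> dist (v 0) (p 0) < r \<longrightarrow>
    (\<forall>k<n. v (Suc k) \<in> proj_set (G (v k)) (v k)) \<longrightarrow> (\<forall>k\<le>n. v k \<in> C \<and> dist (v k) (p k) < e)"
  using p(1) \<open>e > 0\<close>
proof (induction n arbitrary: e)
  case 0
  then show ?case by auto
next
  case (Suc n)
  have pC: "p n \<in> C"
    using unique_orbit_in[of F 1 C "Suc n" p n] F Suc.prems(1) p(2)
    by (simp add: nonexpansive_maps_eq)
  have Fp: "compact (F (p n))" "F (p n) \<noteq> {}"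
    using lipschitz_mapsD[of F 1 C "p n"] F pC by (auto simp: nonexpansive_maps_eq)
  have "proj_set (F (p n)) (p n) = {p (Suc n)}"
    using Suc.prems(1) by (auto simp: unique_orbit_def)
  from proj_set_upper_semicontinuous[OF Fp this Suc.prems(2)]
  obtain d where d: "d > 0"
    "\<And>L v u. \<lbrakk>compact L; L \<noteq> {}; hausdorff_distance (F (p n)) L < d; dist v (p n) < d;
      u \<in> proj_set L v\<rbrakk> \<Longrightarrow> dist u (p (Suc n)) < e" by blast
  have "unique_orbit F n p" using Suc.prems(1) by (auto simp: unique_orbit_def)
  \<comment> \<open>One half of \<open>d\<close> pays for moving from \<open>p n\<close> to
    \<open>v n\<close>, by nonexpansiveness of \<open>F\<close>; the other half pays for replacing
    \<open>F\<close> by \<open>G\<close>.\<close>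
  moreover have "min (d/2) e > 0" using d Suc.prems by simp
  ultimately obtain r where r: "r > 0"
    "\<And>G v k. \<lbrakk>G \<in> nonexpansive_maps C; unif_dist C F G < r; v 0 \<in> C; dist (v 0) (p 0) < r;
      \<forall>k<n. v (Suc k) \<in> proj_set (G (v k)) (v k); k \<le> n\<rbrakk>
      \<Longrightarrow> v k \<in> C \<and> dist (v k) (p k) < min (d/2) e"
    using Suc.IH[of "min (d/2) e"] by blast
  show ?case
  proof (intro exI[of _ "min r (d/2)"] conjI ballI allI impI)
    show "min r (d/2) > 0" using r d by simp
    fix G v k
    assume G: "G \<in> nonexpansive_maps C" and FG: "unif_dist C F G < min r (d/2)"
      and v0: "v 0 \<in> C" "dist (v 0) (p 0) < min r (d/2)"
      and v: "\<forall>k<Suc n. v (Suc k) \<in> proj_set (G (v k)) (v k)" and k: "k \<le> Suc n"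
    have IH: "v k \<in> C \<and> dist (v k) (p k) < min (d/2) e" if "k \<le> n" for k
      using r(2)[of G v k] G FG v0 v that by simp
    have vn: "v n \<in> C" "dist (v n) (p n) < d/2" using IH[of n] by auto
    have Gv: "compact (G (v n))" "G (v n) \<noteq> {}" "G (v n) \<subseteq> C"
      using lipschitz_mapsD[of G 1 C "v n"] G vn by (auto simp: nonexpansive_maps_eq)
    have Fv: "compact (F (v n))" "F (v n) \<noteq> {}"
      using lipschitz_mapsD[of F 1 C "v n"] F vn by (auto simp: nonexpansive_maps_eq)
    have "hausdorff_distance (F (p n)) (G (v n))
        \<le> hausdorff_distance (F (p n)) (F (v n)) + hausdorff_distance (F (v n)) (G (v n))"
      by (rule hausdorff_distance_triangle) (use Fp Fv Gv in auto)
    also have "hausdorff_distance (F (p n)) (F (v n)) \<le> dist (p n) (v n)"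
      using F pC vn by (auto simp: nonexpansive_maps_def)
    also have "hausdorff_distance (F (v n)) (G (v n)) \<le> unif_dist C F G"
      using hausdorff_distance_le_unif_dist[OF C F G vn(1)] .
    finally have H: "hausdorff_distance (F (p n)) (G (v n)) < d"
      using vn(2) FG by (simp add: dist_commute)
    have "v (Suc n) \<in> proj_set (G (v n)) (v n)" using v by simp
    moreover from this have "v (Suc n) \<in> C" using Gv(3) by (auto simp: proj_set_def)
    ultimately have last: "v (Suc n) \<in> C" "dist (v (Suc n)) (p (Suc n)) < e"
      using d(2)[OF Gv(1,2) H, of "v n"] vn(2) d(1) by auto
    show "v k \<in> C" "dist (v k) (p k) < e"
      using IH[of k] last k by (cases "k = Suc n"; simp)+
  qed
qed

text \<open>Any \<open>u\<close> in the projection set at \<open>v k\<close> is a possible next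
  orbit point, hence within half of \<open>\<beta> n\<close> of \<open>p (Suc k)\<close>, and two
  such points are at most \<open>\<beta> n\<close> apart. The case \<open>k = n\<close> involves
  \<open>p (Suc n)\<close>, which is why the orbit has length \<open>Suc n\<close>.\<close>

lemma unique_orbit_small_proj_maps:
  fixes C :: "'a::real_normed_vector set"
  assumes C: "bounded C" and F: "F \<in> nonexpansive_maps C"
    and p: "unique_orbit F (Suc n) p" "p 0 \<in> C" and "\<beta> n > 0"
  shows "\<exists>r>0. \<forall>G\<in>nonexpansive_maps C. unif_dist C F G < r \<longrightarrow> G \<in> small_proj_maps C (p 0) \<beta> n"
proof -
  have "\<beta> n / 2 > 0" using \<open>\<beta> n > 0\<close> by simp
  \<comment> \<open>Stability is needed for each length \<open>m\<close> separately: an orbit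
    stopped at \<open>v k\<close> and prolonged by one nearest point obeys the recursion only up to
    index \<open>Suc k\<close>.\<close>
  have "\<exists>r>0. \<forall>G\<in>nonexpansive_maps C. \<forall>v. unif_dist C F G < r \<longrightarrow> v 0 \<in> C \<longrightarrow>
      dist (v 0) (p 0) < r \<longrightarrow> (\<forall>k<m. v (Suc k) \<in> proj_set (G (v k)) (v k)) \<longrightarrow>
      (\<forall>k\<le>m. v k \<in> C \<and> dist (v k) (p k) < \<beta> n / 2)" if "m \<le> Suc n" for m
  proof -
    have "unique_orbit F m p" using p(1) that by (simp add: unique_orbit_def)
    then show ?thesis using unique_orbit_stable C F p(2) \<open>\<beta> n / 2 > 0\<close> by blast
  qed
  then obtain r where r: "\<And>m. m \<le> Suc n \<Longrightarrow> r m > 0"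
    "\<And>m G v. \<lbrakk>m \<le> Suc n; G \<in> nonexpansive_maps C; unif_dist C F G < r m; v 0 \<in> C;
      dist (v 0) (p 0) < r m; \<forall>k<m. v (Suc k) \<in> proj_set (G (v k)) (v k)\<rbrakk>
      \<Longrightarrow> dist (v m) (p m) < \<beta> n / 2"
    by (metis order_refl)
  define R where "R = Min (r ` {..Suc n})"
  have R: "R > 0" "\<And>m. m \<le> Suc n \<Longrightarrow> R \<le> r m"
    using r(1) by (auto simp: R_def)
  have "G \<in> small_proj_maps C (p 0) \<beta> n" if G: "G \<in> nonexpansive_maps C" "unif_dist C F G < R" for G
  proof -
    have "diameter (proj_set (G (v k)) (v k)) \<le> \<beta> n"
      if v: "\<forall>k\<le>n. v k \<in> C" "norm (v 0 - p 0) < R"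
        "\<forall>k\<in>{1..n}. v k \<in> proj_set (G (v (k - 1))) (v (k - 1))" and k: "k \<le> n" for v k
    proof (rule diameter_le)
      have near: "dist u (p (Suc k)) < \<beta> n / 2" if u: "u \<in> proj_set (G (v k)) (v k)" for u
      proof -
        \<comment> \<open>Overwriting the entry \<open>Suc k\<close> turns \<open>u\<close> into the
          end of an admissible orbit, even if \<open>v\<close> itself continues with another nearest
          point.\<close>
        define w where "w = v(Suc k := u)"
        have "w (Suc j) \<in> proj_set (G (w j)) (w j)" if "j < Suc k" for j
          using v(3)[rule_format, of "Suc j"] u that k by (auto simp: w_def less_Suc_eq)
        then have "dist (w (Suc k)) (p (Suc k)) < \<beta> n / 2"
          using v k G R(2)[of "Suc k"] by (intro r(2)[of _ G]) (auto simp: w_def dist_norm)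
        then show ?thesis by (simp add: w_def)
      qed
      show "norm (x - y) \<le> \<beta> n"
        if "x \<in> proj_set (G (v k)) (v k)" "y \<in> proj_set (G (v k)) (v k)" for x y
        using near[OF that(1)] near[OF that(2)] dist_triangle2[of x y "p (Suc k)"]
        by (simp add: dist_norm)
    qed (use \<open>\<beta> n > 0\<close> in simp)
    then show ?thesis unfolding small_proj_maps_def using G(1) R(1) by blast
  qed
  then show ?thesis using R(1) by blast
qed

section \<open>Transforming the values of a set-valued map\<close>

lemma hausdorff_distance_image_le:
  fixes f g :: "'a::metric_space \<Rightarrow> 'b::metric_space"
  assumes AB: "compact A" "A \<noteq> {}" "compact B" "B \<noteq> {}" and "0 \<le> b"
    and fg: "\<And>x y. \<lbrakk>x \<in> A; y \<in> B\<rbrakk> \<Longrightarrow> dist (f x) (g y) \<le> c + b * dist x y"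
  shows "hausdorff_distance (f ` A) (g ` B) \<le> c + b * hausdorff_distance A B"
proof (rule hausdorff_distance_leI)
  fix u assume "u \<in> f ` A"
  then obtain x where x: "x \<in> A" "u = f x" by blast
  obtain y where y: "y \<in> B" "dist x y \<le> hausdorff_distance A B"
    using hausdorff_distance_near_point AB x by metis
  have "infdist u (g ` B) \<le> dist u (g y)" using y by (intro infdist_le) auto
  also have "\<dots> \<le> c + b * dist x y" using fg x y by auto
  also have "\<dots> \<le> c + b * hausdorff_distance A B" using y \<open>0 \<le> b\<close> by (simp add: mult_left_mono)
  finally show "infdist u (g ` B) \<le> c + b * hausdorff_distance A B" .
next
  fix u assume "u \<in> g ` B"
  then obtain y where y: "y \<in> B" "u = g y" by blast
  obtain x where x: "x \<in> A" "dist y x \<le> hausdorff_distance B A"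
    using hausdorff_distance_near_point AB y by metis
  have "infdist u (f ` A) \<le> dist u (f x)" using x by (intro infdist_le) auto
  also have "\<dots> \<le> c + b * dist y x" using fg[of x y] x y by (simp add: dist_commute)
  also have "\<dots> \<le> c + b * hausdorff_distance A B"
    using x \<open>0 \<le> b\<close> by (simp add: mult_left_mono hausdorff_distance_commute)
  finally show "infdist u (f ` A) \<le> c + b * hausdorff_distance A B" .
qed (use AB in auto)

text \<open>Moving \<open>y\<close> changes the transformation at rate \<open>a\<close>, and it
  moves the set \<open>F y\<close> at rate \<open>L\<close>, which the transformation stretches by
  at most \<open>b\<close>.\<close>

lemma lipschitz_maps_image:
  fixes T :: "'a::metric_space \<Rightarrow> 'a \<Rightarrow> 'a"
  assumes F: "F \<in> lipschitz_maps L C" and "0 \<le> b"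
    and TC: "\<And>y w. \<lbrakk>y \<in> C; w \<in> C\<rbrakk> \<Longrightarrow> T y w \<in> C"
    and T: "\<And>y z w w'. \<lbrakk>y \<in> C; z \<in> C; w \<in> C; w' \<in> C\<rbrakk>
      \<Longrightarrow> dist (T y w) (T z w') \<le> a * dist y z + b * dist w w'"
  shows "(\<lambda>y\<in>C. T y ` F y) \<in> lipschitz_maps (a + b * L) C"
proof -
  \<comment> \<open>For equal first arguments the term with \<open>a\<close> vanishes, so
    \<open>T y\<close> is continuous and the image of \<open>F y\<close> stays compact.\<close>
  have "b-lipschitz_on C (T y)" if "y \<in> C" for y
    using T[of y y] that \<open>0 \<le> b\<close> by (intro lipschitz_onI) auto
  then have "compact (T y ` F y)" if "y \<in> C" for y
    using that lipschitz_mapsD[OF F that]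
    by (meson compact_continuous_image continuous_on_subset lipschitz_on_continuous_on)
  then have "T y ` F y \<in> compacts C" if "y \<in> C" for y
    using that TC lipschitz_mapsD[OF F that] by (auto simp: compacts_def)
  moreover have "hausdorff_distance (T y ` F y) (T z ` F z) \<le> (a + b * L) * dist y z"
    if yz: "y \<in> C" "z \<in> C" for y z
  proof -
    have "hausdorff_distance (T y ` F y) (T z ` F z)
        \<le> a * dist y z + b * hausdorff_distance (F y) (F z)"
    proof (rule hausdorff_distance_image_le)
      show "dist (T y w) (T z w') \<le> a * dist y z + b * dist w w'"
        if "w \<in> F y" "w' \<in> F z" for w w'
        using T yz that lipschitz_mapsD(2)[OF F] by blast
    qed (use lipschitz_mapsD[OF F] yz \<open>0 \<le> b\<close> in auto)
    also have "\<dots> \<le> a * dist y z + b * (L * dist y z)"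
      using F yz \<open>0 \<le> b\<close> by (auto simp: lipschitz_maps_def intro!: mult_left_mono)
    finally show ?thesis by (simp add: algebra_simps)
  qed
  ultimately show ?thesis by (auto simp: lipschitz_maps_def)
qed

lemma hausdorff_distance_image_self_le:
  assumes "A \<noteq> {}" "\<And>x. x \<in> A \<Longrightarrow> dist x (f x) \<le> e"
  shows "hausdorff_distance A (f ` A) \<le> e"
proof (rule hausdorff_distance_leI)
  show "infdist x (f ` A) \<le> e" if "x \<in> A" for x
    using assms(2)[OF that] that by (intro infdist_le2) auto
  show "infdist u A \<le> e" if u: "u \<in> f ` A" for u
  proof -
    obtain x where "x \<in> A" "u = f x" using u by blast
    then show ?thesis using assms(2)[of x] by (intro infdist_le2) (auto simp: dist_commute)
  qed
qed (use assms in auto)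

section \<open>Density of maps with a unique orbit\<close>

lemma bounded_dist_bound:
  fixes S :: "'a::metric_space set"
  assumes "bounded S"
  obtains D where "D > 0" "\<And>y z. \<lbrakk>y \<in> S; z \<in> S\<rbrakk> \<Longrightarrow> dist y z \<le> D"
proof (rule that[of "diameter S + 1"])
  show "diameter S + 1 > 0" using diameter_ge_0[OF assms] by simp
  show "dist y z \<le> diameter S + 1" if "y \<in> S" "z \<in> S" for y z
    using diameter_bounded_bound[OF assms that] by simp
qed

text \<open>All values are shrunk towards a point \<open>c\<close> of \<open>C\<close> by a
  homothety of ratio \<open>1 - l\<close>. Convexity keeps the images in \<open>C\<close>, and no
  point moves by more than \<open>l * D\<close>.\<close>

lemma strict_contraction_dense:
  fixes C :: "'a::real_normed_vector set"
  assumes C: "convex C" "bounded C" "C \<noteq> {}" and F: "F \<in> nonexpansive_maps C" and "e > 0"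
  shows "\<exists>L<1. \<exists>G \<in> lipschitz_maps L C. \<forall>y\<in>C. hausdorff_distance (F y) (G y) \<le> e"
proof -
  obtain c where c: "c \<in> C" using C by blast
  obtain D where D: "D > 0" "\<And>y z. \<lbrakk>y \<in> C; z \<in> C\<rbrakk> \<Longrightarrow> dist y z \<le> D"
    using bounded_dist_bound[OF C(2)] by blast
  \<comment> \<open>\<open>e / D\<close> limits the displacement to \<open>e\<close>;
    \<open>1/2\<close> keeps the ratio positive.\<close>
  define l where "l = min (1/2) (e / D)"
  have l: "0 < l" "l \<le> 1/2" "l \<le> e / D" using D \<open>e > 0\<close>
    unfolding l_def by (simp, linarith+)
  then have lD: "l * D \<le> e" using D by (simp add: field_simps)
  define T where "T = (\<lambda>(y::'a) w. w + l *\<^sub>R (c - w))"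
  have T: "T y w = (1 - l) *\<^sub>R w + l *\<^sub>R c" for y w by (simp add: T_def algebra_simps)
  have "(\<lambda>y\<in>C. T y ` F y) \<in> lipschitz_maps (0 + (1 - l) * 1) C"
  proof (rule lipschitz_maps_image)
    show "dist (T y w) (T z w') \<le> 0 * dist y z + (1 - l) * dist w w'" for y z w w'
    proof -
      have "T y w - T z w' = (1 - l) *\<^sub>R (w - w')" by (simp add: T algebra_simps)
      then show ?thesis using l by (simp add: dist_norm)
    qed
    show "T y w \<in> C" if "y \<in> C" "w \<in> C" for y w
      unfolding T using that c l C(1) by (intro convexD) auto
  qed (use F l in \<open>auto simp: nonexpansive_maps_eq\<close>)
  moreover have "hausdorff_distance (F y) (T y ` F y) \<le> e" if y: "y \<in> C" for y
  proof (rule hausdorff_distance_image_self_le)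
    have Fy: "F y \<noteq> {}" "F y \<subseteq> C" using lipschitz_mapsD[OF F[unfolded nonexpansive_maps_eq] y] by auto
    then show "F y \<noteq> {}" by simp
    show "dist w (T y w) \<le> e" if "w \<in> F y" for w
    proof -
      have "dist w (T y w) = l * dist c w" using l by (simp add: T_def dist_norm)
      also have "\<dots> \<le> l * D" using D(2)[of c w] c Fy that l by (intro mult_left_mono) auto
      finally show ?thesis using lD by simp
    qed
  qed
  ultimately show ?thesis using l
    by (intro exI[of _ "1 - l"] conjI bexI[of _ "\<lambda>y\<in>C. T y ` F y"]) auto
qed

text \<open>Pulling \<open>w\<close> towards \<open>p\<close> by the fraction
  \<open>\<phi> p w\<close> multiplies its distance to \<open>p\<close> by
  \<open>1 - \<phi> p w\<close>. At \<open>q\<close> the old distance is least and the pull is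
  strictly largest, so its image is the unique nearest point. The slack \<open>1 - L\<close> absorbs
  the growth of the Lipschitz constant.\<close>

lemma perturb_unique_proj:
  fixes C :: "'a::real_normed_vector set"
  assumes C: "convex C" "bounded C" and F: "F \<in> lipschitz_maps L C" and "L < 1"
    and p: "p \<in> C" and N: "finite N" "p \<notin> N" and "e > 0"
  shows "\<exists>L'<1. \<exists>G \<in> lipschitz_maps L' C. (\<forall>y\<in>C. hausdorff_distance (F y) (G y) \<le> e) \<and>
    (\<forall>y\<in>N \<inter> C. G y = F y) \<and> (\<exists>q. proj_set (G p) p = {q})"
proof -
  obtain D where D: "D > 0" "\<And>y z. \<lbrakk>y \<in> C; z \<in> C\<rbrakk> \<Longrightarrow> dist y z \<le> D"
    using bounded_dist_bound[OF C(2)] by blast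
  \<comment> \<open>The finite set \<open>N\<close> keeps a positive distance from \<open>p\<close>;
    capping it at 1 later bounds \<open>\<psi>\<close> by 1.\<close>
  obtain s0 where s0: "s0 > 0" "\<And>x. x \<in> N \<Longrightarrow> s0 \<le> dist p x"
    using finite_set_avoid[OF N(1), of p] N(2) by metis
  define s where "s = min 1 s0"
  have s: "0 < s" "s \<le> 1" "\<And>x. x \<in> N \<Longrightarrow> s \<le> dist x p"
    using s0 by (force simp: s_def dist_commute)+
  \<comment> \<open>The three bounds serve, in order, to keep \<open>\<phi>\<close> below 1, to
    limit the displacement to \<open>e\<close>, and to make \<open>L' < 1\<close>, since
    \<open>L'\<close> is at most \<open>L + 2 * \<eta> * D\<close>.\<close>
  define \<eta> where "\<eta> = min (1/2) (min (e / D) ((1 - L) / (4 * D)))"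
  have "0 < \<eta>" using D \<open>e > 0\<close> \<open>L < 1\<close> by (auto simp: \<eta>_def)
  have "\<eta> \<le> 1/2" "\<eta> \<le> e / D" "\<eta> \<le> (1 - L) / (4 * D)" unfolding \<eta>_def by linarith+
  then have \<eta>: "0 < \<eta>" "\<eta> < 1" "\<eta> * D \<le> e" "4 * (\<eta> * D) \<le> 1 - L"
    using D \<open>0 < \<eta>\<close> by (auto simp: field_simps)
  obtain q where q: "q \<in> proj_set (F p) p"
    using proj_set_nonempty lipschitz_mapsD[OF F p] by metis
  \<comment> \<open>Both bumps are 1-Lipschitz with values between 0 and 1. \<open>\<psi>\<close>
    vanishes on \<open>N\<close> and is positive at \<open>p\<close>; \<open>\<kappa>\<close>
    attains its maximum 1 only at \<open>q\<close>.\<close>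
  define \<psi> where "\<psi> y = max 0 (s - dist y p)" for y
  define \<kappa> where "\<kappa> w = max 0 (1 - dist w q)" for w
  have \<psi>: "0 \<le> \<psi> y" "\<psi> y \<le> 1" "\<bar>\<psi> y - \<psi> z\<bar> \<le> dist y z" for y z
    using s(2) zero_le_dist[of y p] dist_triangle[of y p z] dist_triangle[of z p y]
      dist_commute[of y z] unfolding \<psi>_def by linarith+
  have \<kappa>: "0 \<le> \<kappa> w" "\<kappa> w \<le> 1" "\<bar>\<kappa> w - \<kappa> w'\<bar> \<le> dist w w'" for w w'
    using zero_le_dist[of w q] dist_triangle[of w q w'] dist_triangle[of w' q w]
      dist_commute[of w w'] unfolding \<kappa>_def by linarith+
  define \<phi> where "\<phi> y w = \<eta> * (\<psi> y * \<kappa> w)" for y w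
  have \<phi>: "0 \<le> \<phi> y w" "\<phi> y w \<le> \<eta>" for y w
    using \<psi>[of y] \<kappa>[of w] \<eta>(1) by (auto simp: \<phi>_def mult_le_one)
  have \<phi>_lip: "\<bar>\<phi> y w - \<phi> z w'\<bar> \<le> \<eta> * (dist y z + dist w w')" for y z w w'
  proof -
    have "\<phi> y w - \<phi> z w' = \<eta> * ((\<psi> y - \<psi> z) * \<kappa> w + \<psi> z * (\<kappa> w - \<kappa> w'))"
      by (simp add: \<phi>_def algebra_simps)
    then have "\<bar>\<phi> y w - \<phi> z w'\<bar> = \<eta> * \<bar>(\<psi> y - \<psi> z) * \<kappa> w + \<psi> z * (\<kappa> w - \<kappa> w')\<bar>"
      using \<eta>(1) by (simp add: abs_mult)
    also have "\<bar>(\<psi> y - \<psi> z) * \<kappa> w + \<psi> z * (\<kappa> w - \<kappa> w')\<bar>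
        \<le> \<bar>\<psi> y - \<psi> z\<bar> * \<kappa> w + \<psi> z * \<bar>\<kappa> w - \<kappa> w'\<bar>"
      using \<psi>(1)[of z] \<kappa>(1)[of w] abs_triangle_ineq[of "(\<psi> y - \<psi> z) * \<kappa> w" "\<psi> z * (\<kappa> w - \<kappa> w')"]
      by (simp add: abs_mult)
    also have "\<dots> \<le> dist y z * 1 + 1 * dist w w'"
      using \<psi> \<kappa> by (intro add_mono mult_mono) auto
    finally show ?thesis using \<eta>(1) by simp
  qed
  define T where "T y w = w + \<phi> y w *\<^sub>R (p - w)" for y w
  define G where "G = (\<lambda>y\<in>C. T y ` F y)"
  have T_lip: "dist (T y w) (T z w') \<le> (\<eta> * D) * dist y z + (1 + \<eta> * D) * dist w w'"
    if "w' \<in> C" for y z w w'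
  proof -
    \<comment> \<open>The first summand moves only the point, with a factor at most 1; the second
      carries the variation of \<open>\<phi>\<close>, weighted by a distance of at most
      \<open>D\<close>.\<close>
    have "T y w - T z w' = (1 - \<phi> y w) *\<^sub>R (w - w') + (\<phi> y w - \<phi> z w') *\<^sub>R (p - w')"
      by (simp add: T_def algebra_simps)
    then have "dist (T y w) (T z w')
        \<le> norm ((1 - \<phi> y w) *\<^sub>R (w - w')) + norm ((\<phi> y w - \<phi> z w') *\<^sub>R (p - w'))"
      by (metis dist_norm norm_triangle_ineq)
    also have "\<dots> = \<bar>1 - \<phi> y w\<bar> * dist w w' + \<bar>\<phi> y w - \<phi> z w'\<bar> * dist p w'"
      by (simp add: dist_norm)
    also have "\<dots> \<le> 1 * dist w w' + (\<eta> * (dist y z + dist w w')) * D"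
      using \<phi>[of y w] \<eta> \<phi>_lip[of y w z w'] D p that by (intro add_mono mult_mono) auto
    finally show ?thesis by (simp add: algebra_simps)
  qed
  have TC: "T y w \<in> C" if "y \<in> C" "w \<in> C" for y w
  proof -
    have "T y w = (1 - \<phi> y w) *\<^sub>R w + \<phi> y w *\<^sub>R p" by (simp add: T_def algebra_simps)
    then show ?thesis using convexD[OF C(1) that(2) p] \<phi>[of y w] \<eta> by simp
  qed
  define L' where "L' = \<eta> * D + (1 + \<eta> * D) * L"
  have GL: "G \<in> lipschitz_maps L' C"
    unfolding G_def L'_def using F TC T_lip \<eta> D by (intro lipschitz_maps_image) auto
  have "L' < 1"
  proof -
    have "\<eta> * D * L \<le> \<eta> * D * 1" using \<open>L < 1\<close> \<eta> D by (intro mult_left_mono) auto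
    moreover have "0 < \<eta> * D" using \<eta> D by simp
    ultimately show ?thesis using \<eta>(4) by (simp add: L'_def algebra_simps)
  qed
  moreover have "hausdorff_distance (F y) (G y) \<le> e" if y: "y \<in> C" for y
  proof -
    have "hausdorff_distance (F y) (T y ` F y) \<le> e"
    proof (rule hausdorff_distance_image_self_le)
      show "F y \<noteq> {}" using lipschitz_mapsD[OF F y] by simp
      show "dist w (T y w) \<le> e" if "w \<in> F y" for w
      proof -
        have "dist w (T y w) = \<phi> y w * dist p w" using \<phi>[of y w] by (simp add: T_def dist_norm)
        also have "\<dots> \<le> \<eta> * D"
          using D(2)[of p w] p lipschitz_mapsD[OF F y] that \<phi>[of y w] \<eta> by (intro mult_mono) auto
        finally show ?thesis using \<eta> by simp
      qed
    qed
    then show ?thesis using y by (simp add: G_def)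
  qed
  \<comment> \<open>On \<open>N\<close> the bump \<open>\<psi>\<close> is zero, so
    \<open>T y\<close> is the identity.\<close>
  moreover have "G y = F y" if "y \<in> N \<inter> C" for y
    using s(3)[of y] that by (simp add: G_def T_def \<phi>_def \<psi>_def max_def)
  moreover have "proj_set (G p) p = {T p q}"
  proof (rule proj_set_eq_singletonI)
    have qF: "q \<in> F p" using q by (simp add: proj_set_def)
    then show "T p q \<in> G p" using p by (simp add: G_def)
    have Tdist: "dist p (T p w) = (1 - \<phi> p w) * dist p w" for w
    proof -
      have "p - T p w = (1 - \<phi> p w) *\<^sub>R (p - w)" by (simp add: T_def algebra_simps)
      then show ?thesis using \<phi>[of p w] \<eta> by (simp add: dist_norm)
    qed
    fix u assume "u \<in> G p" "u \<noteq> T p q"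
    then obtain w where w: "w \<in> F p" "u = T p w" "w \<noteq> q" using p by (auto simp: G_def)
    have dw: "dist p q \<le> dist p w" using proj_set_le[OF q w(1)] .
    have "\<kappa> w < \<kappa> q" using w by (simp add: \<kappa>_def)
    then have "\<phi> p w < \<phi> p q" using \<eta> s by (simp add: \<phi>_def \<psi>_def)
    show "dist p (T p q) < dist p u"
    \<comment> \<open>If \<open>p = q\<close>, both distances scaled by \<open>dist p q\<close>
      would be zero and give no strict inequality. Then \<open>T p q\<close> is \<open>p\<close>
      itself, while every other image stays at positive distance because
      \<open>\<phi> < 1\<close>.\<close>
    proof (cases "p = q")
      case True
      then have "0 < (1 - \<phi> p w) * dist p w" using w \<phi>[of p w] \<eta> by simp
      then show ?thesis using True w(2) Tdist[of q] Tdist[of w] by simp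
    next
      case False
      then have "(1 - \<phi> p q) * dist p q < (1 - \<phi> p w) * dist p q"
        using \<open>\<phi> p w < \<phi> p q\<close> by simp
      also have "\<dots> \<le> (1 - \<phi> p w) * dist p w"
        using dw \<phi>[of p w] \<eta> by (intro mult_left_mono) auto
      finally show ?thesis using w by (simp add: Tdist)
    qed
  qed
  ultimately show ?thesis using GL by blast
qed

text \<open>The orbit is prolonged one point at a time, each time with half of the remaining
  tolerance. Strict contractivity is part of the conclusion because the next perturbation again
  needs slack in the Lipschitz constant.\<close>

lemma unique_orbit_dense:
  fixes C :: "'a::real_normed_vector set"
  assumes C: "convex C" "bounded C" and x0: "x0 \<in> C"
    and "F \<in> lipschitz_maps L C" "L < 1" "e > 0"
  shows "\<exists>L'<1. \<exists>G \<in> lipschitz_maps L' C. (\<forall>y\<in>C. hausdorff_distance (F y) (G y) \<le> e) \<and>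
    (\<exists>p. p 0 = x0 \<and> unique_orbit G n p)"
  using \<open>e > 0\<close>
proof (induction n arbitrary: e)
  case 0
  have "hausdorff_distance (F y) (F y) \<le> e" if "y \<in> C" for y
    using lipschitz_mapsD[OF assms(4) that] 0 hausdorff_distance_eq_0_iff[of "F y" "F y"] by simp
  moreover have "unique_orbit F 0 (\<lambda>_. x0)" by (simp add: unique_orbit_def)
  ultimately show ?case using assms(4,5) by metis
next
  case (Suc n)
  then obtain L1 G p where L1: "L1 < 1" and G: "G \<in> lipschitz_maps L1 C"
    and FG: "\<And>y. y \<in> C \<Longrightarrow> hausdorff_distance (F y) (G y) \<le> e / 2"
    and p: "p 0 = x0" "unique_orbit G n p"
    using Suc.IH[of "e/2"] by auto
  have pC: "p k \<in> C" if "k \<le> n" for k using unique_orbit_in[OF G p(2)] p x0 that by simp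
  show ?case
  proof (cases "p n \<in> p ` {..<n}")
    case True
    then obtain k where k: "k < n" "p n = p k" by auto
    \<comment> \<open>Since \<open>p n = p k\<close>, the nearest point at \<open>p n\<close> is
      already unique, namely \<open>p (Suc k)\<close>, and \<open>G\<close> is kept.\<close>
    define p' where "p' = p(Suc n := p (Suc k))"
    have "unique_orbit G (Suc n) p'"
      using p(2) k by (auto simp: unique_orbit_def p'_def less_Suc_eq)
    moreover have "hausdorff_distance (F y) (G y) \<le> e" if "y \<in> C" for y
      using FG[OF that] Suc.prems by simp
    moreover have "p' 0 = x0" using p by (simp add: p'_def)
    ultimately show ?thesis using L1 G by blast
  next
    case False
    \<comment> \<open>The protected set consists of the earlier orbit points, where \<open>K\<close>
      agrees with \<open>G\<close>, so the orbit up to \<open>p n\<close> survives.\<close>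
    obtain L2 K q where L2: "L2 < 1" and K: "K \<in> lipschitz_maps L2 C"
      and GK: "\<And>y. y \<in> C \<Longrightarrow> hausdorff_distance (G y) (K y) \<le> e / 2"
      and eq: "\<And>y. y \<in> p ` {..<n} \<inter> C \<Longrightarrow> K y = G y"
      and q: "proj_set (K (p n)) (p n) = {q}"
      using perturb_unique_proj[OF C G L1 pC[OF order_refl] _ False, of "e/2"] Suc.prems
      by auto
    define p' where "p' = p(Suc n := q)"
    have "K (p k) = G (p k)" if "k < n" for k using eq pC that by simp
    then have "unique_orbit K (Suc n) p'"
      using p(2) q by (auto simp: unique_orbit_def p'_def less_Suc_eq)
    moreover have "hausdorff_distance (F y) (K y) \<le> e" if y: "y \<in> C" for y
    proof -
      have "hausdorff_distance (F y) (K y)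
          \<le> hausdorff_distance (F y) (G y) + hausdorff_distance (G y) (K y)"
        using lipschitz_mapsD[OF assms(4) y] lipschitz_mapsD[OF G y] lipschitz_mapsD[OF K y]
        by (intro hausdorff_distance_triangle) auto
      then show ?thesis using FG[OF y] GK[OF y] by simp
    qed
    moreover have "p' 0 = x0" using p by (simp add: p'_def)
    ultimately show ?thesis using L2 K by blast
  qed
qed

text \<open>Passing to a strict contraction and then to a map with a unique orbit costs
  \<open>e/4\<close> each. The total \<open>e/2\<close> leaves a strict inequality after the
  supremum over \<open>C\<close> is taken.\<close>

lemma unique_orbit_dense_nonexpansive:
  fixes C :: "'a::real_normed_vector set"
  assumes C: "convex C" "bounded C" and x0: "x0 \<in> C"
    and F: "F \<in> nonexpansive_maps C" and "e > 0"
  shows "\<exists>G\<in>nonexpansive_maps C. unif_dist C F G < e \<and> (\<exists>p. p 0 = x0 \<and> unique_orbit G n p)"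
proof -
  have "C \<noteq> {}" using x0 by blast
  have "e/4 > 0" using \<open>e > 0\<close> by simp
  from strict_contraction_dense[OF C \<open>C \<noteq> {}\<close> F this] obtain L1 K where K:
    "L1 < 1" "K \<in> lipschitz_maps L1 C" "\<And>y. y \<in> C \<Longrightarrow> hausdorff_distance (F y) (K y) \<le> e/4"
    by blast
  from unique_orbit_dense[OF C x0 K(2,1) \<open>e/4 > 0\<close>, of n] obtain L2 G p where G:
    "L2 < 1" "G \<in> lipschitz_maps L2 C" "\<And>y. y \<in> C \<Longrightarrow> hausdorff_distance (K y) (G y) \<le> e/4"
    "p 0 = x0" "unique_orbit G n p"
    by blast
  have GM: "G \<in> nonexpansive_maps C"
    using G(1,2) lipschitz_maps_mono[of L2 1 C] by (auto simp: nonexpansive_maps_eq)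
  have "hausdorff_distance (F y) (G y) \<le> e/2" if y: "y \<in> C" for y
  proof -
    have "hausdorff_distance (F y) (G y)
        \<le> hausdorff_distance (F y) (K y) + hausdorff_distance (K y) (G y)"
      using lipschitz_mapsD[OF F[unfolded nonexpansive_maps_eq] y]
        lipschitz_mapsD[OF K(2) y] lipschitz_mapsD[OF G(2) y]
      by (intro hausdorff_distance_triangle) auto
    then show ?thesis using K(3)[OF y] G(3)[OF y] by simp
  qed
  then have "unif_dist C F G \<le> e/2"
    using \<open>C \<noteq> {}\<close> F GM by (intro unif_dist_leI) auto
  then have "unif_dist C F G < e" using \<open>e > 0\<close> by simp
  then show ?thesis using GM G(4,5) by blast
qed

section \<open>Open dense subsets and residuality\<close>

lemma nowhere_dense_in_disjoint_open_dense:
  assumes "openin X U" "X closure_of U = topspace X" "N \<subseteq> topspace X - U"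
  shows "nowhere_dense_in X N"
proof -
  have "X closure_of N \<subseteq> topspace X - U"
    using assms by (intro closure_of_minimal) auto
  then have "X interior_of (X closure_of N) \<subseteq> X interior_of (topspace X - U)"
    by (rule interior_of_mono)
  also have "\<dots> = {}" using assms(2) by (simp add: interior_of_complement)
  finally show ?thesis using assms(3) by (auto simp: nowhere_dense_in_def)
qed

text \<open>The complement of the intersection is the union of the complements of the
  \<open>A n\<close>, each of which avoids an open dense set and so is nowhere dense.\<close>

lemma residual_in_INT:
  fixes A :: "nat \<Rightarrow> 'a set"
  assumes "\<And>n. \<exists>U\<subseteq>A n. openin X U \<and> X closure_of U = topspace X" "\<And>n. A n \<subseteq> topspace X"
  shows "residual_in X (\<Inter>n. A n)"
proof -
  have "nowhere_dense_in X (topspace X - A n)" for n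
  proof -
    obtain U where "U \<subseteq> A n" "openin X U" "X closure_of U = topspace X" using assms(1) by blast
    then show ?thesis by (intro nowhere_dense_in_disjoint_open_dense[of X U]) auto
  qed
  then have "meagre_in X (topspace X - (\<Inter>n. A n))"
    unfolding meagre_in_def by (intro exI[of _ "range (\<lambda>n. topspace X - A n)"]) auto
  then show ?thesis using assms(2) by (auto simp: residual_in_def)
qed

theorem theorem5p3:
  fixes C :: "'a::banach set" and x0 :: 'a and \<beta> :: "nat \<Rightarrow> real"
  assumes "C \<noteq> {}" and "closed C" and "convex C" and "bounded C"
    and "x0 \<in> C"
    and "decseq \<beta>" and "\<And>n. \<beta> n > 0" and "\<beta> \<longlonglongrightarrow> 0"
  shows "(\<forall>n. \<exists>U. U \<subseteq> small_proj_maps C x0 \<beta> n \<and> openin (nonexpansive_topology C) U \<and>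
            (nonexpansive_topology C) closure_of U = nonexpansive_maps C) \<and>
         residual_in (nonexpansive_topology C) (\<Inter>n. small_proj_maps C x0 \<beta> n)"
proof -
  let ?M = "nonexpansive_maps C" and ?X = "nonexpansive_topology C"
  interpret M: Metric_space ?M "unif_dist C"
    using Metric_space_nonexpansive_maps assms by blast
  have X: "?X = M.mtopology" by (simp add: nonexpansive_topology_def)
  have open_dense: "\<exists>U\<subseteq>small_proj_maps C x0 \<beta> n. openin ?X U \<and> ?X closure_of U = ?M" for n
  proof -
    \<comment> \<open>\<open>S\<close> supplies density; the union \<open>U\<close> of balls around
      its members, with radii from stability, supplies openness. The index \<open>Suc n\<close>
      provides the nearest point after \<open>p n\<close>.\<close>
    define S where "S = {F \<in> ?M. \<exists>p. p 0 = x0 \<and> unique_orbit F (Suc n) p}"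
    have "\<exists>r>0. \<forall>G\<in>?M. unif_dist C F G < r \<longrightarrow> G \<in> small_proj_maps C x0 \<beta> n" if F: "F \<in> S" for F
      using unique_orbit_small_proj_maps[of C F n _ \<beta>] F assms(4,5,7) by (auto simp: S_def)
    then obtain r where r: "\<And>F. F \<in> S \<Longrightarrow> r F > 0"
      "\<And>F. F \<in> S \<Longrightarrow> M.mball F (r F) \<subseteq> small_proj_maps C x0 \<beta> n"
      by (simp add: subset_iff) metis
    define U where "U = (\<Union>F\<in>S. M.mball F (r F))"
    have "S \<subseteq> U" using r(1) by (auto simp: U_def S_def)
    have "\<exists>G\<in>U. G \<in> M.mball F e" if "F \<in> ?M" "e > 0" for F e
      using unique_orbit_dense_nonexpansive[OF assms(3,4,5) that, of "Suc n"] that \<open>S \<subseteq> U\<close>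
      by (fastforce simp: S_def)
    then have "?X closure_of U = ?M" unfolding X M.metric_closure_of by blast
    moreover have "openin ?X U" unfolding X U_def by blast
    moreover have "U \<subseteq> small_proj_maps C x0 \<beta> n" using r(2) by (auto simp: U_def)
    ultimately show ?thesis by blast
  qed
  moreover have "residual_in ?X (\<Inter>n. small_proj_maps C x0 \<beta> n)"
    using open_dense by (intro residual_in_INT) (auto simp: X small_proj_maps_def)
  ultimately show ?thesis by blast
qed

end
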